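(* Let $n\ge 1$ and let $\Gamma$ be the matching derangement graph on the set $\mathcal{M}_{2n}$ of perfect matchings of $K_{2n}$. The chromatic number of $\Gamma$ is $2n-1$.
   Context: The matching derangement graph $\Gamma$ has vertex set $\mathcal{M}_{2n}$, the set of all perfect matchings of the complete graph $K_{2n}$, and two perfect matchings are adjacent if and only if they share no edge. *)

theory Defs
  imports "Graph_Theory.Graph_Theory"
begin

text \<open>
  Graphs are the symmetric digraphs of \<^locale>\<open>graph\<close>. An undirected edge is represented
  there by two opposite arcs; here it is identified with the set of its two end points.
\<close>

definition edges :: "('a, 'b) pre_digraph \<Rightarrow> 'a set set" where
  "edges G = (\<lambda>(u, v). {u, v}) ` arcs_ends G"

definition matching :: "('a, 'b) pre_digraph \<Rightarrow> 'a set set \<Rightarrow> bool" where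
  "matching G M \<longleftrightarrow> M \<subseteq> edges G \<and> pairwise disjnt M"

definition perfect_matching :: "('a, 'b) pre_digraph \<Rightarrow> 'a set set \<Rightarrow> bool" where
  "perfect_matching G M \<longleftrightarrow> matching G M \<and> \<Union>M = verts G"

definition matching_derangement_graph :: "('a, 'b) pre_digraph \<Rightarrow> 'a set set pair_pre_digraph" where
  "matching_derangement_graph G =
     \<lparr>pverts = {M. perfect_matching G M},
      parcs = {(M, N). perfect_matching G M \<and> perfect_matching G N \<and> M \<inter> N = {}}\<rparr>"

definition proper_coloring :: "('a, 'b) pre_digraph \<Rightarrow> nat \<Rightarrow> ('a \<Rightarrow> nat) \<Rightarrow> bool" where
  "proper_coloring G k c \<longleftrightarrow>
     c ` verts G \<subseteq> {..<k} \<and> (\<forall>(u, v) \<in> arcs_ends G. c u \<noteq> c v)"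

text \<open>The minimum exists for finite loop-free graphs, see \<open>chromatic_number_attained\<close> below.\<close>

definition chromatic_number :: "('a, 'b) pre_digraph \<Rightarrow> nat" where
  "chromatic_number G = (LEAST k. \<exists>c. proper_coloring G k c)"

lemma (in digraph) ex_proper_coloring: "\<exists>c. proper_coloring G (card (verts G)) c"
proof -
  obtain c where c: "bij_betw c (verts G) {0..<card (verts G)}"
    using ex_bij_betw_finite_nat[OF finite_verts] by blast
  have "c u \<noteq> c v" if uv: "(u, v) \<in> arcs_ends G" for u v
  proof -
    from uv obtain e where "e \<in> arcs G" "u = tail G e" "v = head G e"
      by (auto simp: arcs_ends_conv)
    then have "u \<in> verts G" "v \<in> verts G" "u \<noteq> v"
      using no_loops by auto
    then show ?thesis
      using c by (auto simp: bij_betw_def inj_on_def)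
  qed
  moreover have "c ` verts G \<subseteq> {..<card (verts G)}"
    using c by (auto simp: bij_betw_def)
  ultimately show ?thesis
    unfolding proper_coloring_def by blast
qed

lemma (in digraph) chromatic_number_attained: "\<exists>c. proper_coloring G (chromatic_number G) c"
  unfolding chromatic_number_def using ex_proper_coloring by (rule LeastI)

text \<open>
  Without vertices, the empty matching would be adjacent to itself. Otherwise perfect matchings
  are nonempty, so that adjacent ones are distinct.
\<close>

lemma graph_matching_derangement_graph:
  assumes "graph G" and "verts G \<noteq> {}"
  shows "graph (matching_derangement_graph G)"
proof -
  interpret graph G by fact
  let ?P = "{M. perfect_matching G M}"
  have "finite (edges G)"
    by (simp add: edges_def arcs_ends_def)
  moreover have "?P \<subseteq> Pow (edges G)"
    by (auto simp: perfect_matching_def matching_def)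
  ultimately have fin: "finite ?P"
    by (meson finite_Pow_iff finite_subset)
  moreover have "{(M, N). perfect_matching G M \<and> perfect_matching G N \<and> M \<inter> N = {}} \<subseteq> ?P \<times> ?P"
    by auto
  ultimately have fin_arcs: "finite {(M, N). perfect_matching G M \<and> perfect_matching G N \<and> M \<inter> N = {}}"
    by (meson finite_SigmaI finite_subset)
  have ne: "M \<noteq> {}" if "perfect_matching G M" for M
    using that assms(2) by (auto simp: perfect_matching_def)
  show ?thesis
    by unfold_locales
      (auto simp: matching_derangement_graph_def fin fin_arcs arc_to_ends_def symmetric_def
        arcs_ends_def sym_def image_iff dest: ne)
qed

end

theory Submission
  imports Defs "HOL-Number_Theory.Cong"
begin

text \<open>
  Colouring a perfect matching by the partner of a fixed vertex uses \<open>2n - 1\<close> colours. Conversely,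
  the complete graph on \<open>2n\<close> vertices has a 1-factorisation, whose \<open>2n - 1\<close> pairwise disjoint
  perfect matchings form a clique of the derangement graph: label the vertices by
  \<open>0, \<dots>, 2n - 1\<close> and colour the edge \<open>{a, b}\<close> with \<open>a + b\<close> modulo \<open>2n - 1\<close> when
  \<open>a, b < 2n - 1\<close>, and the edge \<open>{a, 2n - 1}\<close> with \<open>2a\<close>.
\<close>

lemma edges_complete:
  assumes "complete_digraph m K"
  shows "edges K = {{u, v} | u v. u \<in> verts K \<and> v \<in> verts K \<and> u \<noteq> v}"
  using assms by (auto simp: edges_def complete_digraph_def)

lemma proper_coloring_derangement_iff:
  "proper_coloring (matching_derangement_graph K) k c \<longleftrightarrow>
    (\<forall>M. perfect_matching K M \<longrightarrow> c M < k) \<and>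
    (\<forall>M N. perfect_matching K M \<longrightarrow> perfect_matching K N \<longrightarrow> M \<inter> N = {} \<longrightarrow> c M \<noteq> c N)"
  by (auto simp: proper_coloring_def matching_derangement_graph_def)

lemma perfect_matching_partner:
  assumes "complete_digraph m K" "perfect_matching K M" "v \<in> verts K"
  obtains w where "w \<in> verts K" "w \<noteq> v" "{v, w} \<in> M"
proof -
  from assms(2,3) obtain e where e: "e \<in> M" "v \<in> e"
    by (auto simp: perfect_matching_def)
  with assms(2) have "e \<in> edges K"
    by (auto simp: perfect_matching_def matching_def)
  then obtain a b where "e = {a, b}" "a \<in> verts K" "b \<in> verts K" "a \<noteq> b"
    by (auto simp: edges_complete[OF assms(1)])
  with e that[of a] that[of b] show ?thesis
    by (auto simp: insert_commute)
qed

lemma ex_proper_coloring_derangement: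
  assumes K: "complete_digraph m K" and "m \<ge> 1"
  shows "\<exists>c. proper_coloring (matching_derangement_graph K) (m - 1) c"
proof -
  interpret graph K
    using K by (simp add: complete_digraph_def)
  from assms obtain v where v: "v \<in> verts K"
    by (fastforce simp: complete_digraph_def)
  with K have "card (verts K - {v}) = m - 1"
    by (simp add: complete_digraph_def)
  \<comment> \<open>The \<open>m - 1\<close> vertices other than \<open>v\<close> are its possible
    partners; \<open>g\<close> turns them into colours.\<close>
  then obtain g where g: "bij_betw g (verts K - {v}) {0..<m - 1}"
    using ex_bij_betw_finite_nat[of "verts K - {v}"] by auto
  \<comment> \<open>\<open>p M\<close> is the partner of \<open>v\<close> in \<open>M\<close>; the
    choice is arbitrary when \<open>M\<close> gives \<open>v\<close> no partner.\<close>
  define p where "p M = (SOME w. w \<in> verts K \<and> w \<noteq> v \<and> {v, w} \<in> M)" for M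
  have p: "p M \<in> verts K - {v}" "{v, p M} \<in> M" if "perfect_matching K M" for M
  proof -
    have "\<exists>w. w \<in> verts K \<and> w \<noteq> v \<and> {v, w} \<in> M"
      using perfect_matching_partner[OF K that v] by blast
    from someI_ex[OF this] show "p M \<in> verts K - {v}" "{v, p M} \<in> M"
      by (auto simp: p_def)
  qed
  have "g (p M) < m - 1" if "perfect_matching K M" for M
    using p(1)[OF that] g by (auto simp: bij_betw_def)
  moreover have "g (p M) \<noteq> g (p N)"
    if "perfect_matching K M" "perfect_matching K N" "M \<inter> N = {}" for M N
  proof
    assume "g (p M) = g (p N)"
    \<comment> \<open>A common partner of \<open>v\<close> would make \<open>{v, p M}\<close> an
      edge of both matchings.\<close>
    then have "p M = p N"
      using g p(1)[OF that(1)] p(1)[OF that(2)] by (auto simp: bij_betw_def inj_on_def)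
    with p(2)[OF that(1)] p(2)[OF that(2)] that(3) show False
      by auto
  qed
  ultimately have "proper_coloring (matching_derangement_graph K) (m - 1) (g \<circ> p)"
    by (simp add: proper_coloring_derangement_iff)
  then show ?thesis
    by blast
qed

text \<open>
  The \<open>m - 1\<close> edges at a vertex have distinct colours, so by counting every colour occurs there.
\<close>

lemma perfect_matching_color_class:
  fixes f :: "'a \<Rightarrow> 'a \<Rightarrow> nat"
  assumes K: "complete_digraph m K"
    and sym: "\<And>x y. f x y = f y x"
    and inj: "\<And>x. x \<in> verts K \<Longrightarrow> inj_on (f x) (verts K - {x})"
    and bound: "\<And>x y. x \<in> verts K \<Longrightarrow> y \<in> verts K \<Longrightarrow> f x y < m - 1"
    and k: "k < m - 1"
  shows "perfect_matching K {{x, y} | x y. x \<in> verts K \<and> y \<in> verts K \<and> x \<noteq> y \<and> f x y = k}"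
    (is "perfect_matching K ?M")
proof -
  interpret graph K
    using K by (simp add: complete_digraph_def)
  have ex: "\<exists>y \<in> verts K - {x}. f x y = k" if x: "x \<in> verts K" for x
  proof -
    have "card (f x ` (verts K - {x})) = card {..<m - 1}"
      using K x by (simp add: card_image[OF inj] complete_digraph_def)
    then have "f x ` (verts K - {x}) = {..<m - 1}"
      using bound x by (intro card_subset_eq) (simp_all add: image_subset_iff)
    with k have "k \<in> f x ` (verts K - {x})"
      by simp
    then show ?thesis
      by (auto simp: image_iff)
  qed
  have unique: "y = z"
    if "x \<in> verts K" "y \<in> verts K - {x}" "z \<in> verts K - {x}" "f x y = k" "f x z = k" for x y z
    using inj[OF that(1)] that(2-) by (auto simp: inj_on_def)
  have "?M \<subseteq> edges K"
    by (auto simp: edges_complete[OF K])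
  moreover have "pairwise disjnt ?M"
  proof (rule pairwiseI)
    fix d e assume "d \<in> ?M" "e \<in> ?M" and ne: "d \<noteq> e"
    show "disjnt d e"
    proof (rule ccontr)
      assume "\<not> disjnt d e"
      then obtain x where "x \<in> d" "x \<in> e"
        by (auto simp: disjnt_def)
      \<comment> \<open>Symmetry of \<open>f\<close> allows \<open>x\<close> to be written as the
        first end point. Two edges of colour \<open>k\<close> through \<open>x\<close> then have the
        same other end point, by injectivity of \<open>f x\<close>.\<close>
      have other: "\<exists>y \<in> verts K - {x}. e = {x, y} \<and> f x y = k \<and> x \<in> verts K"
        if "e \<in> ?M" "x \<in> e" for e
        using that sym by (auto simp: insert_commute)
      obtain y where y: "y \<in> verts K - {x}" "d = {x, y}" "f x y = k" "x \<in> verts K"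
        using other[OF \<open>d \<in> ?M\<close> \<open>x \<in> d\<close>] by blast
      obtain z where z: "z \<in> verts K - {x}" "e = {x, z}" "f x z = k"
        using other[OF \<open>e \<in> ?M\<close> \<open>x \<in> e\<close>] by blast
      from unique[OF y(4,1) z(1) y(3) z(3)] y(2) z(2) ne
      show False by simp
    qed
  qed
  moreover have "\<Union>?M = verts K"
  proof
    show "verts K \<subseteq> \<Union>?M"
    proof
      fix x assume x: "x \<in> verts K"
      from ex[OF x] obtain y where "y \<in> verts K - {x}" "f x y = k" ..
      with x have "{x, y} \<in> ?M"
        by auto
      then show "x \<in> \<Union>?M"
        by blast
    qed
  qed auto
  ultimately show ?thesis
    by (simp add: perfect_matching_def matching_def)
qed

text \<open>Here \<open>f\<close> is a proper edge colouring with \<open>m - 1\<close> colours. Its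
  colour classes are pairwise disjoint perfect matchings, hence a clique on which \<open>c\<close>
  must be injective.\<close>

lemma le_proper_coloring_derangement:
  fixes f :: "'a \<Rightarrow> 'a \<Rightarrow> nat"
  assumes K: "complete_digraph m K"
    and sym: "\<And>x y. f x y = f y x"
    and inj: "\<And>x. x \<in> verts K \<Longrightarrow> inj_on (f x) (verts K - {x})"
    and bound: "\<And>x y. x \<in> verts K \<Longrightarrow> y \<in> verts K \<Longrightarrow> f x y < m - 1"
    and c: "proper_coloring (matching_derangement_graph K) k c"
  shows "m - 1 \<le> k"
proof -
  define M where "M i = {{x, y} | x y. x \<in> verts K \<and> y \<in> verts K \<and> x \<noteq> y \<and> f x y = i}" for i
  have M: "perfect_matching K (M i)" if "i < m - 1" for i
    unfolding M_def using perfect_matching_color_class[OF K sym inj bound that] by blast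
  \<comment> \<open>A common edge would have both colours \<open>i\<close> and \<open>j\<close>,
    whichever way its end points are ordered.\<close>
  have disjoint: "M i \<inter> M j = {}" if "i \<noteq> j" for i j
    using that sym by (auto simp: M_def doubleton_eq_iff)
  have "c (M i) \<noteq> c (M j)" if "i < m - 1" "j < m - 1" "i \<noteq> j" for i j
    using c M[OF that(1)] M[OF that(2)] disjoint[OF that(3)]
    by (simp add: proper_coloring_derangement_iff)
  then have "inj_on (\<lambda>i. c (M i)) {..<m - 1}"
    by (meson inj_onI lessThan_iff)
  moreover have "(\<lambda>i. c (M i)) ` {..<m - 1} \<subseteq> {..<k}"
    using c M by (auto simp: proper_coloring_derangement_iff)
  ultimately show ?thesis
    using card_inj_on_le[of _ "{..<m - 1}" "{..<k}"] by fastforce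
qed

definition round_robin :: "nat \<Rightarrow> nat \<Rightarrow> nat \<Rightarrow> nat" where
  "round_robin m a b =
    (if a = m then 2 * b else if b = m then 2 * a else a + b) mod m"

lemma round_robin_commute: "round_robin m a b = round_robin m b a"
  by (simp add: round_robin_def add.commute)

lemma add_mod_cancel_nat:
  fixes a b c m :: nat
  assumes "(a + b) mod m = (a + c) mod m" "b < m" "c < m"
  shows "b = c"
  using assms by (metis cong_add_lcancel_nat cong_def mod_less)

lemma double_mod_cancel_nat:
  fixes b c m :: nat
  assumes "(2 * b) mod m = (2 * c) mod m" "odd m" "b < m" "c < m"
  shows "b = c"
  using assms by (metis cong_mult_lcancel_nat cong_def mod_less coprime_left_2_iff_odd)

lemma inj_on_round_robin:
  assumes "odd m" "a \<le> m"
  shows "inj_on (round_robin m a) ({..m} - {a})"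
proof (rule inj_onI)
  fix b c
  assume bc: "b \<in> {..m} - {a}" "c \<in> {..m} - {a}"
    and eq: "round_robin m a b = round_robin m a c"
  show "b = c"
  proof (cases "a = m")
    case True
    with bc eq assms(1) double_mod_cancel_nat[of b m c] show ?thesis
      by (simp add: round_robin_def)
  next
    case False
    with assms(2) bc eq show ?thesis
      using add_mod_cancel_nat[of a b m c] add_mod_cancel_nat[of a a m c]
        add_mod_cancel_nat[of a b m a]
      by (auto simp: round_robin_def mult_2 split: if_splits)
  qed
qed

theorem theorem3p3:
  fixes K :: "('a, 'b) pre_digraph" and n :: nat
  assumes "n \<ge> 1" and "complete_digraph (2 * n) K"
  shows "chromatic_number (matching_derangement_graph K) = 2 * n - 1"
proof -
  let ?m = "2 * n - 1"
  interpret graph K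
    using assms(2) by (simp add: complete_digraph_def)
  obtain h where "bij_betw h (verts K) {0..<2 * n}"
    using ex_bij_betw_finite_nat[OF finite_verts] assms(2) by (auto simp: complete_digraph_def)
  moreover have "{0..<2 * n} = {..?m}"
    using assms(1) by auto
  ultimately have h: "inj_on h (verts K)" "h ` verts K = {..?m}"
    by (auto simp: bij_betw_def)
  define f where "f x y = round_robin ?m (h x) (h y)" for x y
  have "inj_on (f x) (verts K - {x})" if x: "x \<in> verts K" for x
  proof -
    have "h x \<le> ?m"
      using h(2) x by auto
    moreover have "h ` (verts K - {x}) = {..?m} - {h x}"
      using h x by (simp add: inj_on_image_set_diff)
    ultimately have "inj_on (round_robin ?m (h x) \<circ> h) (verts K - {x})"
      using assms(1) inj_on_round_robin[of ?m "h x"] inj_on_diff[OF h(1)]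
      by (intro comp_inj_on) simp_all
    then show ?thesis
      by (simp add: f_def[abs_def] comp_def)
  qed
  moreover have "f x y = f y x" for x y
    unfolding f_def by (rule round_robin_commute)
  moreover have "f x y < ?m" for x y
    using assms(1) by (simp add: f_def round_robin_def)
  ultimately have "?m \<le> k" if "proper_coloring (matching_derangement_graph K) k c" for k c
    using le_proper_coloring_derangement[OF assms(2) _ _ _ that] by blast
  then show ?thesis
    unfolding chromatic_number_def
    using ex_proper_coloring_derangement[OF assms(2)] assms(1)
    by (intro Least_equality) auto
qed

end
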